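(* Consider the nonlinear system $\dot x=f(x)+Bu$ with $x\in\mathbb R^n$, $u\in\mathbb R^m$, $f(x)=AZ(x)$, where $A\in\mathbb R^{n\times s}$, $B\in\mathbb R^{n\times m}$ and $Z(x)=\begin{bmatrix} x \\ Q(x) \end{bmatrix}$, with $Z:\mathbb R^n\to\mathbb R^s$ continuously differentiable and $Q:\mathbb R^n\to\mathbb R^{s-n}$ containing only nonlinear functions. Let $U_0,X_1,Z_0$ be the data matrices collected from this system as described in the context. Let $R_Q\in\mathbb R^{n\times\tau}$ be a matrix and $\mathcal X\subseteq\mathbb R^n$ a set such that $$\frac{\partial Q}{\partial x}(x)^\top\frac{\partial Q}{\partial x}(x)\preceq R_QR_Q^\top\quad\text{for any }x\in\mathcal X.$$ Consider the following semidefinite program in the decision variables $P\in\mathbb S^{n\times n}$, $Y_1\in\mathbb R^{T\times n}$, $G_2\in\mathbb R^{T\times(s-n)}$, $\alpha\in\mathbb R_{>0}$: $$P\succ0,\qquad Z_0Y_1=\begin{bmatrix} P \\ 0_{(s-n)\times n} \end{bmatrix},$$ $$\begin{bmatrix} X_1Y_1+(X_1Y_1)^\top+\alpha I_n & \star & \star \\ G_2^\top X_1^\top & -I_{s-n} & \star \\ R_Q^\top P & 0 & -I_\tau \end{bmatrix}\preceq0,$$ $$Z_0G_2=\begin{bmatrix} 0_{n\times(s-n)} \\ I_{s-n} \end{bmatrix}.$$ If the program is feasible, then the control law $u=KZ(x)$ with $K=U_0\begin{bmatrix} Y_1P^{-1} & G_2 \end{bmatrix}$ is such that the closed-loop dynamics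 $\dot x=(A+BK)Z(x)$ are exponentially contractive on $\mathcal X$, i.e., there exist $P\in\mathbb S^{n\times n}$, $P\succ0$, and $\beta>0$ such that for all $x\in\mathcal X$ $$\Big((A+BK)\frac{\partial Z(x)}{\partial x}\Big)^\top P^{-1}+P^{-1}(A+BK)\frac{\partial Z(x)}{\partial x}\preceq-\beta P^{-1}.$$
   Context: $\mathbb S^{n\times n}$ is the set of real symmetric $n\times n$ matrices; $\succ,\succeq,\prec,\preceq$ refer to (semi)definiteness; $\star$ denotes entries determined by symmetry of the block matrix. The matrices $A,B$ are unknown to the designer, while $Z$ is known. Data: for an integer $T>0$ and distinct sampling times $t_0<\dots<t_{T-1}$, samples $x_i=x(t_i)$, $u_i=u(t_i)$, $\dot x_i=\dot x(t_i)$, satisfying $\dot x_i=AZ(x_i)+Bu_i$ for $i=0,\dots,T-1$, are collected in $$U_0=[u_0\ \cdots\ u_{T-1}]\in\mathbb R^{m\times T},\quad X_1=[\dot x_0\ \cdots\ \dot x_{T-1}]\in\mathbb R^{n\times T},\quad Z_0=[Z(x_0)\ \cdots\ Z(x_{T-1})]\in\mathbb R^{s\times T},$$ so that $X_1=AZ_0+BU_0$. *)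

theory Defs
  imports "HOL-Analysis.Analysis"
begin

text \<open>As usual for the relations \<open>\<succ>\<close> and \<open>\<preceq>\<close>, definiteness includes symmetry.\<close>

definition pos_def :: "real^'n^'n \<Rightarrow> bool" where
  "pos_def M \<longleftrightarrow> transpose M = M \<and> (\<forall>v. v \<noteq> 0 \<longrightarrow> v \<bullet> (M *v v) > 0)"

definition pos_semidef :: "real^'n^'n \<Rightarrow> bool" where
  "pos_semidef M \<longleftrightarrow> transpose M = M \<and> (\<forall>v. v \<bullet> (M *v v) \<ge> 0)"

definition loewner_le :: "real^'n^'n \<Rightarrow> real^'n^'n \<Rightarrow> bool" (infix "\<preceq>\<^sub>L" 50) where
  "M \<preceq>\<^sub>L N \<longleftrightarrow> pos_semidef (N - M)"

text \<open>
  Blocks are indexed by sum types.  \<open>vstack\<close> applies both to vectors (entries \<open>'a = real\<close>)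
  and to matrices, whose entries \<open>'a = real^'c\<close> are the rows.
\<close>

definition vstack :: "'a^'p \<Rightarrow> 'a^'q \<Rightarrow> 'a^('p + 'q)" where
  "vstack M N = (\<chi> i. case i of Inl j \<Rightarrow> M $ j | Inr k \<Rightarrow> N $ k)"

definition hstack :: "'a^'p^'r \<Rightarrow> 'a^'q^'r \<Rightarrow> 'a^('p + 'q)^'r" where
  "hstack M N = (\<chi> i. vstack (M $ i) (N $ i))"

text \<open>The symmetric 3-by-3 block matrix given by its lower triangular blocks, row by row.\<close>

definition sym_block3 ::
  "real^'a^'a \<Rightarrow> real^'a^'b \<Rightarrow> real^'b^'b \<Rightarrow> real^'a^'c \<Rightarrow> real^'b^'c \<Rightarrow> real^'c^'c
    \<Rightarrow> real^('a + 'b + 'c)^('a + 'b + 'c)" where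
  "sym_block3 M11 M21 M22 M31 M32 M33 =
     vstack (hstack M11 (hstack (transpose M21) (transpose M31)))
    (vstack (hstack M21 (hstack M22 (transpose M32)))
            (hstack M31 (hstack M32 M33)))"

definition matrix_of_columns :: "('t::finite \<Rightarrow> 'a^'r) \<Rightarrow> 'a^'t^'r" where
  "matrix_of_columns c = (\<chi> i j. c j $ i)"

definition continuously_differentiable :: "(real^'n \<Rightarrow> real^'m) \<Rightarrow> bool" where
  "continuously_differentiable f \<longleftrightarrow>
     (\<forall>x. f differentiable (at x)) \<and> continuous_on UNIV (\<lambda>x. jacobian f (at x))"

definition sdp_feasible_point ::
  "real^'t^('n + 'q) \<Rightarrow> real^'t^'n \<Rightarrow> real^'r^'n
    \<Rightarrow> real^'n^'n \<Rightarrow> real^'n^'t \<Rightarrow> real^'q^'t \<Rightarrow> real \<Rightarrow> bool" where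
  "sdp_feasible_point Z0 X1 RQ P Y1 G2 \<alpha> \<longleftrightarrow>
     \<alpha> > 0 \<and>
     pos_def P \<and>
     Z0 ** Y1 = vstack P 0 \<and>
     sym_block3
       (X1 ** Y1 + transpose (X1 ** Y1) + \<alpha> *\<^sub>R mat 1)
       (transpose G2 ** transpose X1) (- mat 1)
       (transpose RQ ** P)            0          (- mat 1)
     \<preceq>\<^sub>L 0 \<and>
     Z0 ** G2 = vstack 0 (mat 1)"

end

theory Submission
  imports Defs
begin

text \<open>
  Feasibility gives \<open>Z\<^sub>0 [Y\<^sub>1 P\<^sup>-\<^sup>1  G\<^sub>2] = I\<close>, so the unknown closed-loop matrix equals
  \<open>X\<^sub>1 [Y\<^sub>1 P\<^sup>-\<^sup>1  G\<^sub>2]\<close>.  For a displacement \<open>v = P w\<close> at \<open>\<xi>\<close> put \<open>d = \<partial>Q/\<partial>x(\<xi>) v\<close>; the block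
  inequality evaluated at \<open>(w, d, R\<^sub>Q\<^sup>T v)\<close> reads
  \<open>2 w\<^sup>T X\<^sub>1 (Y\<^sub>1 w + G\<^sub>2 d) + \<alpha> |w|\<^sup>2 \<le> |d|\<^sup>2 - |R\<^sub>Q\<^sup>T v|\<^sup>2 \<le> 0\<close>.  With \<open>w\<^sup>T P w \<le> c |w|\<^sup>2\<close>,
  contraction with the metric \<open>P\<^sup>-\<^sup>1\<close> and rate \<open>\<beta> = \<alpha> / c\<close> follows.
\<close>

section \<open>Block vectors and block matrices\<close>

lemma vstack_nth [simp]: "vstack x y $ Inl i = x $ i" "vstack x y $ Inr j = y $ j"
  by (simp_all add: vstack_def)

lemma sum_UNIV_Plus:
  "(\<Sum>k\<in>UNIV. f k) = (\<Sum>i\<in>UNIV. f (Inl i)) + (\<Sum>j\<in>UNIV. f (Inr j))"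
  for f :: "'p::finite + 'q::finite \<Rightarrow> 'a::comm_monoid_add"
  unfolding UNIV_Plus_UNIV [symmetric] by (subst sum.Plus) (simp_all add: comp_def)

lemma inner_vstack:
  fixes a :: "real^'p::finite" and b :: "real^'q::finite"
  shows "vstack a b \<bullet> vstack c d = a \<bullet> c + b \<bullet> d"
  by (simp add: inner_vec_def sum_UNIV_Plus)

lemma vstack_add: "vstack (a :: 'a::plus^'p::finite) (b :: 'a^'q::finite) + vstack c d = vstack (a + c) (b + d)"
  by (simp add: vec_eq_iff vstack_def split: sum.split)

lemma vstack_mult_vec:
  fixes M :: "real^'c^'p::finite" and N :: "real^'c^'q::finite"
  shows "vstack M N *v v = vstack (M *v v) (N *v v)"
  by (simp add: vec_eq_iff matrix_vector_mult_def vstack_def split: sum.split)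

lemma hstack_mult_vstack:
  fixes M :: "real^'p::finite^'r" and N :: "real^'q::finite^'r"
  shows "hstack M N *v vstack a b = M *v a + N *v b"
  by (simp add: vec_eq_iff matrix_vector_mult_def hstack_def sum_UNIV_Plus)

text \<open>Adjointness, phrased with \<open>v*\<close> because simplification turns
  \<open>transpose M *v y\<close> into \<open>y v* M\<close>.\<close>

lemma inner_vector_matrix_mult: "x \<bullet> (y v* M) = (M *v x) \<bullet> y" for M :: "real^'n^'m"
  unfolding inner_commute [of x] dot_lmul_matrix by (rule inner_commute)

text \<open>Each off-diagonal block enters once as itself and once transposed; by adjointness both
  contributions agree, which produces the factors 2.\<close>

lemma sym_block3_quadratic_form:
  "vstack a (vstack b c) \<bullet> (sym_block3 M11 M21 M22 M31 M32 M33 *v vstack a (vstack b c)) =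
     a \<bullet> (M11 *v a) + b \<bullet> (M22 *v b) + c \<bullet> (M33 *v c)
     + 2 * (b \<bullet> (M21 *v a)) + 2 * (c \<bullet> (M31 *v a)) + 2 * (c \<bullet> (M32 *v b))"
proof -
  have "a \<bullet> (b v* M21) = b \<bullet> (M21 *v a)" "a \<bullet> (c v* M31) = c \<bullet> (M31 *v a)"
    "b \<bullet> (c v* M32) = c \<bullet> (M32 *v b)"
    by (simp_all only: inner_vector_matrix_mult inner_commute)
  then show ?thesis
    by (simp add: sym_block3_def vstack_mult_vec hstack_mult_vstack inner_vstack inner_add_right)
qed

section \<open>Definite matrices\<close>

lemma transpose_add: "transpose (M + N) = transpose M + transpose (N :: 'a::plus^'n^'m)"
  by (simp add: transpose_def vec_eq_iff)

lemma transpose_diff: "transpose (M - N) = transpose M - transpose (N :: 'a::minus^'n^'m)"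
  by (simp add: transpose_def vec_eq_iff)

lemma pos_def_imp_invertible:
  assumes "pos_def M"
  shows "invertible M"
proof -
  have "v = 0" if "M *v v = 0" for v
    using assms that by (force simp: pos_def_def)
  then show ?thesis
    by (simp add: invertible_left_inverse matrix_left_invertible_ker)
qed

lemma invertible_imp_matrix_inv:
  assumes "invertible M"
  shows "M ** matrix_inv M = mat 1" "matrix_inv M ** M = mat 1"
  using someI_ex [OF assms [unfolded invertible_def]] by (simp_all add: matrix_inv_def)

text \<open>Transposing \<open>matrix_inv M ** M = mat 1\<close> shows that the transposed inverse
  is a right inverse of \<open>M\<close>, and a right inverse coincides with a left one.\<close>

lemma transpose_matrix_inv_symmetric:
  fixes M :: "real^'n^'n"
  assumes "invertible M" and sym: "transpose M = M"
  shows "transpose (matrix_inv M) = matrix_inv M"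
proof -
  note inv = invertible_imp_matrix_inv [OF assms(1)]
  have right_inv: "M ** transpose (matrix_inv M) = mat 1"
    using arg_cong [OF inv(2), of transpose] by (simp add: matrix_transpose_mul sym)
  have "transpose (matrix_inv M) = (matrix_inv M ** M) ** transpose (matrix_inv M)"
    by (simp add: inv)
  also have "\<dots> = matrix_inv M"
    unfolding matrix_mul_assoc [symmetric] right_inv by simp
  finally show ?thesis .
qed

text \<open>Cauchy-Schwarz together with boundedness of the linear map. The constant
  \<open>c\<close> later converts decay in the Euclidean norm into decay in the metric.\<close>

lemma quadratic_form_le:
  fixes M :: "real^'n^'n"
  obtains c where "c > 0" "\<And>v. v \<bullet> (M *v v) \<le> c * (v \<bullet> v)"
proof -
  obtain c where c: "c > 0" "\<And>v. norm (M *v v) \<le> norm v * c"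
    using bounded_linear.pos_bounded [OF matrix_vector_mul_bounded_linear] by blast
  have "v \<bullet> (M *v v) \<le> c * (v \<bullet> v)" for v
  proof -
    have "v \<bullet> (M *v v) \<le> norm v * norm (M *v v)"
      by (rule norm_cauchy_schwarz)
    also have "\<dots> \<le> norm v * (norm v * c)"
      by (intro mult_left_mono c) simp
    finally show ?thesis
      by (simp add: dot_square_norm power2_eq_square mult_ac)
  qed
  with c(1) show thesis
    by (rule that)
qed

lemma loewner_le_iff:
  "M \<preceq>\<^sub>L N \<longleftrightarrow> transpose (N - M) = N - M \<and> (\<forall>v. v \<bullet> (M *v v) \<le> v \<bullet> (N *v v))"
  by (simp add: loewner_le_def pos_semidef_def matrix_vector_mult_diff_rdistrib inner_diff_right)

section \<open>The closed loop\<close>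

text \<open>Differentiability is assumed for the whole graph map; that of \<open>Q\<close> follows
  by projecting onto components. Uniqueness of derivatives then identifies both blocks.\<close>

lemma jacobian_graph:
  fixes Q :: "real^'n::finite \<Rightarrow> real^'q::finite"
  assumes "(\<lambda>\<xi>. vstack \<xi> (Q \<xi>)) differentiable at x"
  shows "jacobian (\<lambda>\<xi>. vstack \<xi> (Q \<xi>)) (at x) *v v = vstack v (jacobian Q (at x) *v v)"
proof -
  let ?Z = "\<lambda>\<xi>. vstack \<xi> (Q \<xi>)"
  let ?J = "jacobian ?Z (at x)"
  have Z: "(?Z has_derivative (\<lambda>h. ?J *v h)) (at x)"
    using assms jacobian_works by blast
  have comp: "((\<lambda>\<xi>. ?Z \<xi> $ k) has_derivative (\<lambda>h. (?J *v h) $ k)) (at x)" for k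
    by (rule bounded_linear.has_derivative [OF bounded_linear_vec_nth Z])
  have fst: "(?J *v v) $ Inl i = v $ i" for i
  proof -
    have "((\<lambda>\<xi>. \<xi> $ i) has_derivative (\<lambda>h. (?J *v h) $ Inl i)) (at x)"
      using comp [of "Inl i"] by simp
    moreover have "((\<lambda>\<xi>. \<xi> $ i) has_derivative (\<lambda>h. h $ i)) (at x)"
      by (rule bounded_linear_imp_has_derivative [OF bounded_linear_vec_nth])
    ultimately show ?thesis
      by (rule fun_cong [OF has_derivative_unique])
  qed
  have Q: "(Q has_derivative (\<lambda>h. \<chi> j. (?J *v h) $ Inr j)) (at x)"
    unfolding has_derivative_componentwise_within [of Q]
    using comp [of "Inr _"] by (auto simp: Basis_vec_def inner_axis)
  \<comment> \<open>\<open>jacobian\<close> rests on a choice of derivative, so it is meaningful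
    only now that some derivative of \<open>Q\<close> has been exhibited.\<close>
  then have "(Q has_derivative (\<lambda>h. jacobian Q (at x) *v h)) (at x)"
    using differentiable_def jacobian_works by blast
  then have "(\<lambda>h. jacobian Q (at x) *v h) = (\<lambda>h. \<chi> j. (?J *v h) $ Inr j)"
    using Q by (rule has_derivative_unique)
  then have snd: "jacobian Q (at x) *v v = (\<chi> j. (?J *v v) $ Inr j)"
    by (rule fun_cong)
  show ?thesis
    unfolding vec_eq_iff snd
  proof
    show "(?J *v v) $ k = vstack v (\<chi> j. (?J *v v) $ Inr j) $ k" for k
      by (cases k) (simp_all add: fst)
  qed
qed

lemma matrix_of_columns_dynamics:
  fixes A :: "real^'s^'n" and B :: "real^'m^'n"
  assumes "\<And>i. d i = A *v z i + B *v w i"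
  shows "matrix_of_columns d = A ** matrix_of_columns z + B ** matrix_of_columns w"
  by (simp add: assms matrix_of_columns_def vec_eq_iff matrix_matrix_mult_def matrix_vector_mult_def)

text \<open>The unknown \<open>A\<close> and \<open>B\<close> disappear: the input is
  \<open>U0 *v y\<close> and the state vector is \<open>Z0 *v y\<close> for one and the same
  \<open>y = Y1 *v w + G2 *v d\<close>, so the data equation yields \<open>X1 *v y\<close>.\<close>

lemma closed_loop_data_representation:
  fixes A :: "real^('n::finite + 'q::finite)^'n" and U0 :: "real^'t^'m"
  assumes X1: "X1 = A ** Z0 + B ** U0"
    and ZY: "Z0 ** Y1 = vstack P 0"
    and ZG: "Z0 ** G2 = vstack 0 (mat 1)"
    and P: "invertible P"
  shows "(A + B ** (U0 ** hstack (Y1 ** matrix_inv P) G2)) *v vstack (P *v w) d =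
    (X1 ** Y1) *v w + (X1 ** G2) *v d"
proof -
  let ?y = "Y1 *v w + G2 *v d"
  have inv: "matrix_inv P *v (P *v w) = w"
    by (simp add: invertible_imp_matrix_inv P matrix_vector_mul_assoc)
  have "Z0 *v ?y = (Z0 ** Y1) *v w + (Z0 ** G2) *v d"
    by (simp add: matrix_vector_right_distrib matrix_vector_mul_assoc)
  also have "\<dots> = vstack (P *v w) d"
    unfolding ZY ZG by (simp add: vstack_mult_vec vstack_add)
  finally have Zy: "Z0 *v ?y = vstack (P *v w) d" .
  have "hstack (Y1 ** matrix_inv P) G2 *v vstack (P *v w) d = ?y"
    by (simp add: hstack_mult_vstack inv flip: matrix_vector_mul_assoc)
  then have "(A + B ** (U0 ** hstack (Y1 ** matrix_inv P) G2)) *v vstack (P *v w) d =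
      A *v (Z0 *v ?y) + B *v (U0 *v ?y)"
    by (simp add: matrix_vector_mult_add_rdistrib Zy flip: matrix_vector_mul_assoc)
  also have "\<dots> = X1 *v ?y"
    by (simp add: X1 matrix_vector_mult_add_rdistrib matrix_vector_mul_assoc)
  finally show ?thesis
    by (simp add: matrix_vector_right_distrib matrix_vector_mul_assoc)
qed

lemma sdp_feasible_point_imp_decrease:
  assumes feas: "sdp_feasible_point Z0 X1 RQ P Y1 G2 \<alpha>"
    and d: "d \<bullet> d \<le> (transpose RQ *v (P *v w)) \<bullet> (transpose RQ *v (P *v w))"
  shows "2 * (w \<bullet> ((X1 ** Y1) *v w + (X1 ** G2) *v d)) \<le> - \<alpha> * (w \<bullet> w)"
proof -
  let ?c = "transpose RQ *v (P *v w)"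
  \<comment> \<open>The last block maximises \<open>2 * (c \<bullet> ?c) - c \<bullet> c\<close>
    over \<open>c\<close>, leaving \<open>+ ?c \<bullet> ?c\<close>. This is a Schur complement
    taken at a single vector; the remaining \<open>- d \<bullet> d\<close> is compensated by the
    bound on \<open>d\<close>.\<close>
  let ?x = "vstack w (vstack d ?c)"
  let ?M11 = "X1 ** Y1 + transpose (X1 ** Y1) + \<alpha> *\<^sub>R mat 1"
  let ?M21 = "transpose G2 ** transpose X1"
  have "?x \<bullet> (sym_block3 ?M11 ?M21 (- mat 1) (transpose RQ ** P) 0 (- mat 1) *v ?x) \<le> 0"
    using feas by (simp add: sdp_feasible_point_def loewner_le_iff)
  moreover have "w \<bullet> (?M11 *v w) = 2 * (w \<bullet> ((X1 ** Y1) *v w)) + \<alpha> * (w \<bullet> w)"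
    by (simp add: matrix_vector_mult_add_rdistrib inner_add_right inner_vector_matrix_mult
        inner_commute flip: scaleR_matrix_vector_assoc)
  moreover have "d \<bullet> (?M21 *v w) = w \<bullet> ((X1 ** G2) *v d)"
    unfolding matrix_transpose_mul [symmetric] transpose_matrix_vector inner_vector_matrix_mult
    by (rule inner_commute)
  moreover have neg: "- mat 1 *v y = - y" for y :: "real^'x::finite"
    using matrix_vector_mult_diff_rdistrib [of 0 "mat 1" y] by simp
  ultimately show ?thesis
    using d unfolding sym_block3_quadratic_form
    by (simp add: neg inner_add_right flip: matrix_vector_mul_assoc)
qed

text \<open>For symmetric \<open>M\<close> the two summands have equal quadratic forms, and the
  symmetry demanded by the order is automatic. Contraction thus becomes a scalar inequality.\<close>

lemma lyapunov_le_iff: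
  fixes F M :: "real^'n^'n"
  assumes "transpose M = M"
  shows "transpose F ** M + M ** F \<preceq>\<^sub>L c *\<^sub>R M \<longleftrightarrow>
    (\<forall>v. 2 * ((M *v v) \<bullet> (F *v v)) \<le> c * (v \<bullet> (M *v v)))"
proof -
  have "v \<bullet> ((transpose F ** M + M ** F) *v v) = 2 * ((M *v v) \<bullet> (F *v v))" for v
  proof -
    have "v \<bullet> (M *v (F *v v)) = (M *v v) \<bullet> (F *v v)"
      using inner_vector_matrix_mult [of v _ M] transpose_matrix_vector [of M] by (simp add: assms)
    moreover have "v \<bullet> (transpose F *v (M *v v)) = (M *v v) \<bullet> (F *v v)"
      by (simp add: inner_vector_matrix_mult inner_commute)
    ultimately show ?thesis
      by (simp add: matrix_vector_mult_add_rdistrib inner_add_right flip: matrix_vector_mul_assoc)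
  qed
  moreover have "transpose (c *\<^sub>R M - (transpose F ** M + M ** F)) =
      c *\<^sub>R M - (transpose F ** M + M ** F)"
    by (simp add: transpose_diff transpose_add transpose_scalar matrix_transpose_mul assms
        add.commute)
  ultimately show ?thesis
    by (simp add: loewner_le_iff flip: scaleR_matrix_vector_assoc)
qed

theorem theorem1:
  fixes A :: "real^('n::finite + 'q::finite)^'n"
    and B :: "real^'m^'n"
    and Q :: "real^'n \<Rightarrow> real^'q"
    and Z :: "real^'n \<Rightarrow> real^('n + 'q)"
    and t :: "'t::{finite,linorder} \<Rightarrow> real"
    and J :: "real set"
    and x xdot :: "real \<Rightarrow> real^'n"
    and u :: "real \<Rightarrow> real^'m"
    and U0 :: "real^('t::{finite,linorder})^'m"
    and X1 :: "real^('t::{finite,linorder})^'n"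
    and Z0 :: "real^('t::{finite,linorder})^('n + 'q)"
    and RQ :: "real^'r^'n"
    and X :: "(real^'n) set"
    and P :: "real^'n^'n"
    and Y1 :: "real^'n^('t::{finite,linorder})"
    and G2 :: "real^'q^('t::{finite,linorder})"
    and \<alpha> :: real
    and K :: "real^('n + 'q)^'m"
  assumes Z: "\<And>\<xi>. Z \<xi> = vstack \<xi> (Q \<xi>)"
    and Z_C1: "continuously_differentiable Z"
    and Q_nonlinear: "\<And>i. \<not> linear (\<lambda>\<xi>. Q \<xi> $ i)"
    and times: "strict_mono t" "is_interval J" "range t \<subseteq> J"
    and xdot: "\<And>i. (x has_vector_derivative xdot (t i)) (at (t i) within J)"
    and dynamics: "\<And>i. xdot (t i) = A *v Z (x (t i)) + B *v u (t i)"
    and U0: "U0 = matrix_of_columns (\<lambda>i. u (t i))"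
    and X1: "X1 = matrix_of_columns (\<lambda>i. xdot (t i))"
    and Z0: "Z0 = matrix_of_columns (\<lambda>i. Z (x (t i)))"
    and RQ: "\<And>\<xi>. \<xi> \<in> X \<Longrightarrow>
      transpose (jacobian Q (at \<xi>)) ** jacobian Q (at \<xi>) \<preceq>\<^sub>L RQ ** transpose RQ"
    and feasible: "sdp_feasible_point Z0 X1 RQ P Y1 G2 \<alpha>"
    and K: "K = U0 ** hstack (Y1 ** matrix_inv P) G2"
  shows "\<exists>(S :: real^'n^'n) \<beta>. pos_def S \<and> \<beta> > 0 \<and>
    (\<forall>\<xi>\<in>X.
      transpose ((A + B ** K) ** jacobian Z (at \<xi>)) ** matrix_inv S
        + matrix_inv S ** ((A + B ** K) ** jacobian Z (at \<xi>))
      \<preceq>\<^sub>L (- \<beta>) *\<^sub>R matrix_inv S)"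
proof -
  have P: "pos_def P" and \<alpha>: "\<alpha> > 0"
    and ZY: "Z0 ** Y1 = vstack P 0" and ZG: "Z0 ** G2 = vstack 0 (mat 1)"
    using feasible by (simp_all add: sdp_feasible_point_def)
  have inv: "invertible P"
    by (rule pos_def_imp_invertible [OF P])
  have sym: "transpose (matrix_inv P) = matrix_inv P"
    using P by (simp add: transpose_matrix_inv_symmetric inv pos_def_def)
  have X1': "X1 = A ** Z0 + B ** U0"
    unfolding X1 Z0 U0 by (rule matrix_of_columns_dynamics) (rule dynamics)
  obtain c where c: "c > 0" "\<And>v. v \<bullet> (P *v v) \<le> c * (v \<bullet> v)"
    using quadratic_form_le by blast
  show ?thesis
  \<comment> \<open>The metric comes from the feasible \<open>P\<close> itself. The rate is the
    margin \<alpha> divided by the bound \<open>c\<close> on the quadratic form of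
    \<open>P\<close>.\<close>
  proof (intro exI [of _ P] exI [of _ "\<alpha> / c"] conjI ballI)
    show "pos_def P" "\<alpha> / c > 0"
      using P \<alpha> c(1) by simp_all
    fix \<xi> assume \<xi>: "\<xi> \<in> X"
    let ?F = "(A + B ** K) ** jacobian Z (at \<xi>)"
    have "2 * ((matrix_inv P *v v) \<bullet> (?F *v v)) \<le> - (\<alpha> / c) * (v \<bullet> (matrix_inv P *v v))" for v
    proof -
      \<comment> \<open>In the coordinate \<open>w\<close> the metric term
        \<open>v \<bullet> (matrix_inv P *v v)\<close> becomes \<open>w \<bullet> (P *v w)\<close>,
        and no inverse remains to be estimated.\<close>
      define w where "w = matrix_inv P *v v"
      let ?d = "jacobian Q (at \<xi>) *v v"
      have v: "P *v w = v"
        by (simp add: w_def inv invertible_imp_matrix_inv matrix_vector_mul_assoc)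
      have "v \<bullet> ((transpose (jacobian Q (at \<xi>)) ** jacobian Q (at \<xi>)) *v v)
          \<le> v \<bullet> ((RQ ** transpose RQ) *v v)"
        using RQ [OF \<xi>] by (simp add: loewner_le_iff)
      \<comment> \<open>Both sides of the Jacobian bound are Gram matrices, so their quadratic forms
        are squared norms.\<close>
      then have d: "?d \<bullet> ?d \<le> (transpose RQ *v (P *v w)) \<bullet> (transpose RQ *v (P *v w))"
        using inner_vector_matrix_mult [of v "v v* RQ" "transpose RQ"]
        by (simp add: v inner_vector_matrix_mult flip: matrix_vector_mul_assoc)
      have "Z = (\<lambda>\<xi>. vstack \<xi> (Q \<xi>))"
        using Z by blast
      then have "jacobian Z (at \<xi>) *v v = vstack (P *v w) ?d"
        using Z_C1 by (simp add: continuously_differentiable_def jacobian_graph v)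
      then have "?F *v v = (X1 ** Y1) *v w + (X1 ** G2) *v ?d"
        unfolding K using closed_loop_data_representation [OF X1' ZY ZG inv, of w ?d]
        by (simp flip: matrix_vector_mul_assoc)
      then have "2 * (w \<bullet> (?F *v v)) \<le> - \<alpha> * (w \<bullet> w)"
        using sdp_feasible_point_imp_decrease [OF feasible d] by simp
      \<comment> \<open>The upper bound on \<open>w \<bullet> (P *v w)\<close> is multiplied by
        \<open>\<alpha> / c\<close> and negated.\<close>
      also have "\<dots> \<le> - (\<alpha> / c) * (w \<bullet> (P *v w))"
        using mult_left_mono [OF c(2) [of w], of "\<alpha> / c"] c(1) \<alpha> by simp
      finally show ?thesis
        by (simp add: v inner_commute flip: w_def)
    qed
    then show "transpose ?F ** matrix_inv P + matrix_inv P ** ?F \<preceq>\<^sub>L (- (\<alpha> / c)) *\<^sub>R matrix_inv P"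
      unfolding lyapunov_le_iff [OF sym] by blast
  qed
qed

end
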